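(* Let $n\ge 1$ and let $\pi_1,\dots,\pi_n$ be arbitrary (not necessarily distinct) cyclic permutations of $[2^n]$. For $i\in[2^n]$ define the binary $n$-tuple $$\Pi(T_n,i)=\big(c_{n,n}(\pi_n(i)),\,c_{n-1,n}(\pi_{n-1}(i)),\,\dots,\,c_{1,n}(\pi_1(i))\big).$$ Then the $2^n$ tuples $\Pi(T_n,1),\dots,\Pi(T_n,2^n)$ are pairwise distinct.
   Context: For a nonnegative integer $m$ and $i\ge1$, $\mathrm{bin}(m,i)$ denotes the $i$-th bit of the binary expansion of $m$, counted from the least significant bit (so $\mathrm{bin}(m,1)$ is the least significant bit, and $\mathrm{bin}(m,i)=0$ beyond the most significant bit). For $i\in[n]$, $c_{i,n}$ is the $0$-$1$ list of length $2^n$ with $c_{i,n}(j)=\mathrm{bin}(j-1,i)$ for $j\in[2^n]$. The $n$-Bit-Table $T_n$ is the $2^n\times n$ table with columns $c_{n,n},c_{n-1,n},\dots,c_{1,n}$ (so its $j$-th row is the $n$-bit binary expansion of $j-1$). A cyclic permutation of order $k\ge0$ on $[m]$ is the map $i\mapsto 1+((i+k-1)\bmod m)$. $\Pi(T_n)$ is the table obtained from $T_n$ by applying $\pi_\ell$ to the column $c_{\ell,n}$, and $\Pi(T_n,i)$ is its $i$-th row. *)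

theory Defs
  imports Main
begin

(* Bits are numbered from 1 and the library's bit from 0; only i >= 1 is meaningful. *)
definition bin :: "nat \<Rightarrow> nat \<Rightarrow> nat" where
  "bin m i = of_bool (bit m (i - 1))"

definition col :: "nat \<Rightarrow> nat \<Rightarrow> nat list" where
  "col i n = map (\<lambda>j. bin (j - 1) i) [1..<2 ^ n + 1]"

(* The entry of a list at a position counted from 1, so that c_{i,n}(j) is entry (col i n) j. *)
definition entry :: "'a list \<Rightarrow> nat \<Rightarrow> 'a" where
  "entry xs j = xs ! (j - 1)"

definition cyclic_perm :: "nat \<Rightarrow> nat \<Rightarrow> nat \<Rightarrow> nat" where
  "cyclic_perm m k i = 1 + (i + k - 1) mod m"

(* Only the values on {1..m} are constrained. *)
definition is_cyclic_perm :: "nat \<Rightarrow> (nat \<Rightarrow> nat) \<Rightarrow> bool" where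
  "is_cyclic_perm m f \<longleftrightarrow> (\<exists>k. \<forall>i\<in>{1..m}. f i = cyclic_perm m k i)"

(* Row i of the n-Bit-Table after its column c_{l,n} has been permuted by p l;
   the columns are listed from l = n down to l = 1. *)
definition perm_row :: "nat \<Rightarrow> (nat \<Rightarrow> nat \<Rightarrow> nat) \<Rightarrow> nat \<Rightarrow> nat list" where
  "perm_row n p i = map (\<lambda>l. entry (col l n) (p l i)) (rev [1..<n + 1])"

lemma bin_eq: "bin m i = m div 2 ^ (i - 1) mod 2"
  by (simp add: bin_def bit_iff_odd mod_2_eq_odd)

lemma length_col: "length (col i n) = 2 ^ n"
  by (simp add: col_def)

lemma entry_col: "j \<in> {1..2 ^ n} \<Longrightarrow> entry (col i n) j = bin (j - 1) i"
  by (auto simp: entry_def col_def simp del: upt_Suc)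

lemma cyclic_perm_in: "m \<ge> 1 \<Longrightarrow> cyclic_perm m k i \<in> {1..m}"
  by (simp add: cyclic_perm_def Suc_le_eq)

end

theory Submission
  imports Defs "HOL-Number_Theory.Cong"
begin

text \<open>Shifting column \<open>l\<close> by \<open>k\<close> replaces bit \<open>l\<close> of \<open>i - 1\<close> by bit \<open>l\<close> of
  \<open>i - 1 + k\<close>. Read the columns from the least significant one. If \<open>i\<close> and \<open>j\<close> are already
  known to agree modulo \<open>2 ^ m\<close>, then so do \<open>i + k\<close> and \<open>j + k\<close>; equality of their next bit
  lifts this to a congruence modulo \<open>2 ^ (m + 1)\<close>, and the shift \<open>k\<close> cancels.\<close>

lemma cong_pow2_SucI:
  fixes a b k :: nat
  assumes "[a = b] (mod 2 ^ m)" and "bit (a + k) m \<longleftrightarrow> bit (b + k) m"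
  shows "[a = b] (mod 2 ^ Suc m)"
proof -
  have "[a + k = b + k] (mod 2 ^ m)"
    using assms(1) by (simp add: cong_add_rcancel_nat)
  then have "take_bit m (a + k) = take_bit m (b + k)"
    by (simp add: cong_def take_bit_eq_mod)
  with assms(2) have "take_bit (Suc m) (a + k) = take_bit (Suc m) (b + k)"
    by (simp only: take_bit_Suc_from_most)
  then have "[a + k = b + k] (mod 2 ^ Suc m)"
    by (simp only: cong_def take_bit_eq_mod)
  then show ?thesis
    by (simp only: cong_add_rcancel_nat)
qed

text \<open>The shift may change from bit to bit, since each one cancels before the next bit is
  compared.\<close>

lemma cong_pow2I:
  fixes a b :: nat and k :: "nat \<Rightarrow> nat"
  assumes "\<And>l. l < m \<Longrightarrow> bit (a + k l) l \<longleftrightarrow> bit (b + k l) l"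
  shows "[a = b] (mod 2 ^ m)"
  using assms by (induction m) (auto intro: cong_pow2_SucI simp del: power_Suc)

text \<open>Wrapping around modulo \<open>2 ^ n\<close> is \<open>take_bit n\<close>, which keeps
  all bits below \<open>n\<close>, so no column sees it. With \<open>i \<ge> 1\<close> the truncated
  \<open>i + k - 1\<close> equals \<open>i - 1 + k\<close>.\<close>

lemma entry_col_cyclic_perm:
  assumes "l \<in> {1..n}" and "i \<ge> 1"
  shows "entry (col l n) (cyclic_perm (2 ^ n) k i) = of_bool (bit (i - 1 + k) (l - 1))"
proof -
  have "entry (col l n) (cyclic_perm (2 ^ n) k i) = bin (take_bit n (i - 1 + k)) l"
    using assms(2) entry_col[OF cyclic_perm_in[of "2 ^ n" k i], of l]
    by (simp add: cyclic_perm_def take_bit_eq_mod)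
  then show ?thesis
    using assms(1) by (auto simp: bin_def bit_take_bit_iff)
qed

theorem theorem6:
  fixes n :: nat and p :: "nat \<Rightarrow> nat \<Rightarrow> nat"
  assumes "n \<ge> 1"
    and "\<forall>l\<in>{1..n}. is_cyclic_perm (2 ^ n) (p l)"
  shows "inj_on (perm_row n p) {1..2 ^ n}"
proof (rule inj_onI)
  fix i j
  assume i: "i \<in> {1..2 ^ n}" and j: "j \<in> {1..2 ^ n}" and eq: "perm_row n p i = perm_row n p j"
  obtain k where k: "p l x = cyclic_perm (2 ^ n) (k l) x" if "l \<in> {1..n}" "x \<in> {1..2 ^ n}" for l x
    using assms(2) unfolding is_cyclic_perm_def by metis
  have "entry (col l n) (p l i) = entry (col l n) (p l j)" if "l \<in> {1..n}" for l
    using eq that by (auto simp: perm_row_def map_eq_conv simp del: upt_Suc)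
  then have "bit (i - 1 + k l) (l - 1) \<longleftrightarrow> bit (j - 1 + k l) (l - 1)" if "l \<in> {1..n}" for l
    using that i j by (metis atLeastAtMost_iff entry_col_cyclic_perm k of_bool_eq_iff)
  \<comment> \<open>Columns count from 1 and bits from 0: bit \<open>l\<close> is shifted by
    \<open>k (Suc l)\<close>.\<close>
  from this[of "Suc _"] have "[i - 1 = j - 1] (mod 2 ^ n)"
    by (intro cong_pow2I[where k = "\<lambda>l. k (Suc l)"]) simp
  with i j have "i - 1 = j - 1"
    by (intro cong_less_modulus_unique_nat) auto
  with i j show "i = j"
    by auto
qed

end
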